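(* Let $F_2$ be the free group on two generators $a$ and $b$. For any $w\in F_2\setminus\{a,b,a^{-1},b^{-1},e\}$, of word length $l$, the set $$\{g\in F_2 : |o(g,w)-o(g,w^{-1})|\le 3l\}$$ is an approximate subgroup of $F_2$ but is not a Meyer subset.
   Context: Elements of $F_2$ are identified with reduced words in $a^{\pm1},b^{\pm1}$. For reduced words $x,w$, $o(x,w)$ denotes the number of occurrences of $w$ as a (contiguous) sub-word of the reduced word $x$, counted with overlaps. An approximate subgroup of a group $G$ is a subset $\Lambda \subset G$ with $\Lambda=\Lambda^{-1}$, $e\in\Lambda$, and $\Lambda\Lambda\subset F\Lambda$ for some finite $F\subset G$. Subsets $X,Y\subset G$ are commensurable if there is a finite $F\subset G$ with $X\subset FY$ and $Y\subset FX$. A good model of an approximate subgroup $\Lambda$ is a group homomorphism $f:\langle\Lambda\rangle\to H$ from the subgroup generated by $\Lambda$ to a locally compact group $H$ such that $f(\Lambda)$ is relatively compact and there is a neighbourhood $U\subset H$ of the identity with $f^{-1}(U)\subset\Lambda$. An approximate subgroup of $G$ is a Meyer subset if it is commensurable to an approximate subgroup of $G$ that has a good model. *)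

theory Defs
  imports "HOL-Analysis.Analysis" "HOL-Algebra.Coset" "HOL-Algebra.Generated_Groups"
begin

section \<open>The free group on two generators, as the group of reduced words\<close>

datatype gen = Gen_a | Gen_b

text \<open>The letter \<open>(s, True)\<close> is the generator \<open>s\<close> and \<open>(s, False)\<close> is its formal inverse.\<close>

type_synonym letter = "gen \<times> bool"
type_synonym word = "letter list"

definition inv_letter :: "letter \<Rightarrow> letter" where
  "inv_letter l = (fst l, \<not> snd l)"

definition reduced :: "word \<Rightarrow> bool" where
  "reduced = successively (\<lambda>l m. m \<noteq> inv_letter l)"

fun cons_reduce :: "letter \<Rightarrow> word \<Rightarrow> word" where
  "cons_reduce l [] = [l]"
| "cons_reduce l (m # y) = (if m = inv_letter l then y else l # m # y)"

text \<open>For a reduced word \<open>y\<close>, \<open>foldr cons_reduce x y\<close> is the reduced form of the concatenation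
  \<open>x @ y\<close>.\<close>

definition F2 :: "word monoid" where
  "F2 = \<lparr>carrier = {x. reduced x}, mult = foldr cons_reduce, one = []\<rparr>"

definition gen_a :: word where "gen_a = [(Gen_a, True)]"
definition gen_b :: word where "gen_b = [(Gen_b, True)]"

text \<open>Occurrences of \<open>w\<close> as a contiguous sub-word of \<open>x\<close> are the decompositions
  \<open>x = u @ w @ v\<close>; distinct occurrences may overlap.\<close>

definition occ :: "word \<Rightarrow> word \<Rightarrow> nat" where
  "occ x w = card {(u, v). x = u @ w @ v}"

lemma inv_letter_invol [simp]: "inv_letter (inv_letter l) = l"
  by (simp add: inv_letter_def)

lemma inv_letter_neq [simp]: "inv_letter l \<noteq> l"
  by (cases l) (simp add: inv_letter_def)

lemma reduced_Nil [simp]: "reduced []"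
  by (simp add: reduced_def)

lemma reduced_Cons:
  "reduced (l # x) \<longleftrightarrow> reduced x \<and> (x = [] \<or> hd x \<noteq> inv_letter l)"
  by (auto simp: reduced_def successively_Cons)

lemma reduced_cons_reduce: "reduced y \<Longrightarrow> reduced (cons_reduce l y)"
  by (cases y) (auto simp: reduced_Cons)

lemma reduced_foldr: "reduced y \<Longrightarrow> reduced (foldr cons_reduce x y)"
  by (induction x) (auto simp: reduced_cons_reduce)

lemma cons_reduce_reduced: "reduced (l # x) \<Longrightarrow> cons_reduce l x = l # x"
  by (cases x) (auto simp: reduced_Cons)

lemma cons_reduce_cancel: "reduced y \<Longrightarrow> cons_reduce l (cons_reduce (inv_letter l) y) = y"
  by (cases y) (auto simp: cons_reduce_reduced)

lemma foldr_cons_reduce_Nil: "reduced x \<Longrightarrow> foldr cons_reduce x [] = x"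
  by (induction x) (auto simp: reduced_Cons cons_reduce_reduced)

lemma foldr_cons_reduce:
  assumes "reduced z"
  shows "foldr cons_reduce (cons_reduce l y) z = cons_reduce l (foldr cons_reduce y z)"
  using assms cons_reduce_cancel[of "foldr cons_reduce (tl y) z" l]
  by (cases y) (auto simp: reduced_foldr)

lemma foldr_cons_reduce_assoc:
  assumes "reduced z"
  shows "foldr cons_reduce (foldr cons_reduce x y) z = foldr cons_reduce x (foldr cons_reduce y z)"
  using assms by (induction x) (auto simp: foldr_cons_reduce)

lemma foldr_cons_reduce_inverse:
  "reduced x \<Longrightarrow> reduced z \<Longrightarrow>
    foldr cons_reduce (rev (map inv_letter x)) (foldr cons_reduce x z) = z"
proof (induction x)
  case (Cons l x)
  have "cons_reduce (inv_letter l) (cons_reduce l (foldr cons_reduce x z)) = foldr cons_reduce x z"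
    using cons_reduce_cancel[of "foldr cons_reduce x z" "inv_letter l"] Cons.prems
    by (simp add: reduced_foldr)
  then show ?case
    using Cons by (simp add: reduced_Cons)
qed simp

lemma group_F2: "group F2"
proof (rule groupI)
  fix x assume x: "x \<in> carrier F2"
  let ?y = "foldr cons_reduce (rev (map inv_letter x)) []"
  have "foldr cons_reduce ?y x = foldr cons_reduce (rev (map inv_letter x)) (foldr cons_reduce x [])"
    using x by (simp add: F2_def foldr_cons_reduce_assoc foldr_cons_reduce_Nil)
  also have "\<dots> = []"
    using x by (simp add: F2_def foldr_cons_reduce_inverse)
  finally show "\<exists>y\<in>carrier F2. y \<otimes>\<^bsub>F2\<^esub> x = \<one>\<^bsub>F2\<^esub>"
    by (intro bexI[of _ ?y]) (auto simp: F2_def reduced_foldr)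
qed (auto simp: F2_def reduced_foldr foldr_cons_reduce_assoc)


section \<open>Approximate subgroups, good models and Meyer subsets\<close>

definition approximate_subgroup :: "('a, 'b) monoid_scheme \<Rightarrow> 'a set \<Rightarrow> bool" where
  "approximate_subgroup G \<Lambda> \<longleftrightarrow>
     \<Lambda> \<subseteq> carrier G \<and> set_inv\<^bsub>G\<^esub> \<Lambda> = \<Lambda> \<and> \<one>\<^bsub>G\<^esub> \<in> \<Lambda> \<and>
     (\<exists>F. finite F \<and> F \<subseteq> carrier G \<and> \<Lambda> <#>\<^bsub>G\<^esub> \<Lambda> \<subseteq> F <#>\<^bsub>G\<^esub> \<Lambda>)"

definition commensurable :: "('a, 'b) monoid_scheme \<Rightarrow> 'a set \<Rightarrow> 'a set \<Rightarrow> bool" where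
  "commensurable G X Y \<longleftrightarrow>
     (\<exists>F. finite F \<and> F \<subseteq> carrier G \<and> X \<subseteq> F <#>\<^bsub>G\<^esub> Y \<and> Y \<subseteq> F <#>\<^bsub>G\<^esub> X)"

text \<open>No Hausdorff axiom is imposed.  Dividing by the closure of the identity shows that imposing
  it would not change which approximate subgroups have a good model.\<close>

definition locally_compact_group :: "('h, 'c) monoid_scheme \<Rightarrow> 'h topology \<Rightarrow> bool" where
  "locally_compact_group H T \<longleftrightarrow>
     group H \<and> topspace T = carrier H \<and>
     continuous_map (prod_topology T T) T (\<lambda>(x, y). x \<otimes>\<^bsub>H\<^esub> y) \<and>
     continuous_map T T (\<lambda>x. inv\<^bsub>H\<^esub> x) \<and>
     locally_compact_space T"

definition good_model ::
  "('a, 'b) monoid_scheme \<Rightarrow> 'a set \<Rightarrow> ('h, 'c) monoid_scheme \<Rightarrow> 'h topology \<Rightarrow> ('a \<Rightarrow> 'h) \<Rightarrow> bool"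
where
  "good_model G \<Lambda> H T f \<longleftrightarrow>
     locally_compact_group H T \<and>
     f \<in> hom (G\<lparr>carrier := generate G \<Lambda>\<rparr>) H \<and>
     compactin T (T closure_of (f ` \<Lambda>)) \<and>
     (\<exists>U. U \<subseteq> carrier H \<and> \<one>\<^bsub>H\<^esub> \<in> T interior_of U \<and> {x \<in> generate G \<Lambda>. f x \<in> U} \<subseteq> \<Lambda>)"

text \<open>HOL cannot quantify over types inside a formula, so the type \<open>'h\<close> carrying the locally compact
  group is a parameter.  A theorem asserting \<open>\<not> meyer_subset TYPE('h) G X\<close> for a type variable
  \<open>'h\<close> rules out good models in all locally compact groups.\<close>

definition meyer_subset :: "'h itself \<Rightarrow> ('a, 'b) monoid_scheme \<Rightarrow> 'a set \<Rightarrow> bool" where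
  "meyer_subset _ G X \<longleftrightarrow>
     (\<exists>\<Lambda>. approximate_subgroup G \<Lambda> \<and> commensurable G X \<Lambda> \<and>
       (\<exists>(H :: 'h monoid) T f. good_model G \<Lambda> H T f))"

end

theory Submission
  imports Defs "HOL-Library.Sublist"
begin

text \<open>The function \<open>\<phi> g = o(g, w) - o(g, w\<inverse>)\<close> is a quasimorphism with defect at most \<open>3 (l - 1)\<close>:
  write \<open>g = u c\<close> and \<open>h = c\<inverse> v\<close> with \<open>g h = u v\<close> reduced; each of the three concatenations creates
  at most \<open>l - 1\<close> new occurrences.  Hence \<open>\<Lambda> \<Lambda>\<close> is covered by finitely many translates of \<open>\<Lambda>\<close>, one
  for each value of \<open>\<phi>\<close> that occurs on it.

  If \<open>\<Lambda>\<close> were Meyer, pulling back small neighbourhoods of the identity from a good model would give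
  a finite set \<open>F\<close> and, for every \<open>t\<close>, a set \<open>A\<close> such that \<open>(x y z)\<^sup>t \<in> F \<Lambda>\<close> for all \<open>x, y, z \<in> A\<close> and
  such that, by compactness, every sequence in \<open>\<Lambda>\<close> has two members with \<open>g\<^sub>i\<inverse> g\<^sub>j \<in> A\<close>.  Taking
  \<open>g\<^sub>i = z\<^sup>i c\<inverse>\<close> for a letter \<open>z\<close>, the set \<open>A\<close> contains \<open>c z\<^sup>k c\<inverse>\<close> for some large \<open>k\<close>.  Three
  such elements with product \<open>e\<close> such that \<open>|\<phi> (e\<^sup>t)|\<close> grows linearly in \<open>t\<close> contradict the
  boundedness of \<open>\<phi>\<close> on \<open>F \<Lambda>\<close>.

  If \<open>w = x\<^sup>i p\<close> has end letters from different generators, \<open>e = x\<^sup>k p x\<^sup>-\<^sup>m p\<inverse>\<close> works.  Otherwise let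
  \<open>w = u x\<^sup>n\<close>, \<open>c = u x\<inverse>\<close>, \<open>d = x\<^sup>n\<^sup>+\<^sup>1\<close>, so that \<open>w = c d\<close>: powers of the other generator \<open>z\<close> separate
  the occurrences of \<open>w\<close>, and \<open>e = z\<^sup>k c z\<^sup>m d z\<^sup>q w\<inverse>\<close> works because \<open>\<phi> c + \<phi> d \<noteq> \<phi> w\<close>.\<close>

section \<open>Occurrences of sub-words\<close>

lemma occ_Nil:
  assumes "w \<noteq> []"
  shows "occ [] w = 0"
  using assms by (simp add: occ_def)

lemma occ_Cons:
  "occ (a # x) w = occ x w + of_bool (prefix w (a # x))"
proof -
  \<comment> \<open>\<open>card\<close> is 0 on infinite sets, so the cardinality of the union below
    requires finiteness.\<close>
  have fin: "finite {(u, v). x = u @ w @ v}" for x :: word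
  proof (rule finite_subset)
    show "{(u, v). x = u @ w @ v} \<subseteq> set (prefixes x) \<times> set (suffixes x)"
      by (auto simp: suffix_def)
  qed simp
  let ?S = "{(u, v). x = u @ w @ v}"
  let ?P = "{(u, v). u = [] \<and> a # x = w @ v}"
  have "{(u, v). a # x = u @ w @ v} = (\<lambda>(u, v). (a # u, v)) ` ?S \<union> ?P"
    by (auto simp: Cons_eq_append_conv image_iff)
  moreover have "card ((\<lambda>(u, v). (a # u, v)) ` ?S) = card ?S"
    by (intro card_image) (auto simp: inj_on_def)
  moreover have "?P = (if prefix w (a # x) then {([], drop (length w) (a # x))} else {})"
    by (auto simp: prefix_def)
  ultimately show ?thesis
    using fin[of x] by (auto simp: occ_def card_Un_disjoint card_insert_if)
qed

lemma prefix_append_long: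
  "length w \<le> length x \<Longrightarrow> prefix w (x @ y) \<longleftrightarrow> prefix w x"
  by (metis prefix_append prefix_length_le prefix_length_prefix prefixI prefix_order.trans)

lemma occ_short:
  assumes "w \<noteq> []" "length x \<le> length w"
  shows "occ x w = of_bool (x = w)"
  using assms
proof (induction x)
  case (Cons a x)
  have "prefix w (a # x) \<longleftrightarrow> a # x = w"
    using Cons.prems by (metis prefix_length_le prefix_order.antisym prefix_order.refl
        prefix_def append_eq_append_conv append_Nil2 le_antisym)
  then show ?case
    using Cons by (auto simp: occ_Cons)
qed (simp add: occ_Nil)

lemma occ_append_ge: "w \<noteq> [] \<Longrightarrow> occ x w + occ y w \<le> occ (x @ y) w"
proof (induction x)
  case (Cons a x)
  have "prefix w (a # x) \<Longrightarrow> prefix w (a # x @ y)"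
    by (metis append_Cons prefix_prefix)
  then show ?case
    using Cons by (auto simp: occ_Cons)
qed (simp add: occ_Nil)

text \<open>A new occurrence straddles the junction, so it starts among the last
  \<open>length w - 1\<close> letters of \<open>x\<close>. The \<open>min\<close> carries the
  induction: the bound grows by one per letter only while \<open>x\<close> is shorter than
  \<open>w\<close>; after that \<open>y\<close> no longer affects the prefix test.\<close>

lemma occ_append_le:
  assumes "w \<noteq> []"
  shows "occ (x @ y) w \<le> occ x w + occ y w + min (length x) (length w - 1)"
proof (induction x)
  case (Cons a x)
  show ?case
  proof (cases "length w \<le> length (a # x)")
    case True
    then have "prefix w (a # x @ y) \<longleftrightarrow> prefix w (a # x)"
      using prefix_append_long[of w "a # x" y] by simp
    then show ?thesis
      using Cons by (auto simp: occ_Cons)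
  qed (use Cons in \<open>auto simp: occ_Cons\<close>)
qed simp

text \<open>Inclusion-exclusion: an occurrence meeting both \<open>x\<close> and \<open>y\<close>
  would have at least \<open>length s + 2\<close> letters, so each lies in \<open>x @ s\<close> or
  in \<open>s @ y\<close>, and those in both lie in \<open>s\<close>.\<close>

lemma occ_overlap:
  assumes "w \<noteq> []" "length w \<le> Suc (length s)"
  shows "occ (x @ s @ y) w + occ s w = occ (x @ s) w + occ (s @ y) w"
proof (induction x)
  case (Cons a x)
  have "prefix w (a # x @ s @ y) \<longleftrightarrow> prefix w (a # x @ s)"
    using prefix_append_long[of w "a # x @ s" y] assms by simp
  then show ?case
    using Cons by (simp add: occ_Cons)
qed simp

lemma occ_replicate_append:
  assumes "w \<noteq> []" "hd w \<noteq> z"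
  shows "occ (replicate k z @ x) w = occ x w"
  using assms by (induction k) (auto simp: occ_Cons prefix_def Cons_eq_append_conv neq_Nil_conv)

section \<open>Inverse words and free reduction\<close>

definition inv_word :: "word \<Rightarrow> word" where
  "inv_word x = rev (map inv_letter x)"

lemma inj_inv_letter: "inj inv_letter"
  by (metis injI inv_letter_invol)

lemma inv_word_simps [simp]:
  "inv_word [] = []"
  "inv_word (a # x) = inv_word x @ [inv_letter a]"
  "inv_word (x @ y) = inv_word y @ inv_word x"
  "inv_word (inv_word x) = x"
  "length (inv_word x) = length x"
  "inv_word (replicate k a) = replicate k (inv_letter a)"
  "inv_word x = [] \<longleftrightarrow> x = []"
  by (simp_all add: inv_word_def rev_map comp_def)

lemma inv_word_eq_iff: "inv_word x = y \<longleftrightarrow> x = inv_word y"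
  by auto

lemma hd_inv_word [simp]: "x \<noteq> [] \<Longrightarrow> hd (inv_word x) = inv_letter (last x)"
  by (simp add: inv_word_def hd_rev last_map)

lemma last_inv_word [simp]: "x \<noteq> [] \<Longrightarrow> last (inv_word x) = inv_letter (hd x)"
  by (simp add: inv_word_def last_rev hd_map)

lemma fst_inv_letter [simp]: "fst (inv_letter a) = fst a"
  by (simp add: inv_letter_def)

lemma reduced_append:
  "reduced (x @ y) \<longleftrightarrow>
    reduced x \<and> reduced y \<and> (x = [] \<or> y = [] \<or> hd y \<noteq> inv_letter (last x))"
  by (auto simp: reduced_def successively_append_iff)

lemma reduced_inv_word [simp]: "reduced (inv_word x) \<longleftrightarrow> reduced x"
proof -
  have "reduced (inv_word x)" if "reduced x" for x
    using that
  proof (induction x)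
    case (Cons a x)
    then show ?case
      by (cases "x = []") (auto simp: reduced_Cons reduced_append)
  qed simp
  then show ?thesis
    by (metis inv_word_simps(4))
qed

lemma reduced_replicate [simp]: "reduced (replicate k a)"
  by (induction k) (auto simp: reduced_Cons hd_replicate, metis inv_letter_neq)

text \<open>Stripping the first and last letters of a self-inverse word leaves a self-inverse word.
  This ends at a letter equal to its inverse or at two adjacent cancelling letters.\<close>

lemma inv_word_neq:
  assumes "reduced x" "x \<noteq> []"
  shows "inv_word x \<noteq> x"
  using assms
proof (induction "length x" arbitrary: x rule: less_induct)
  case less
  obtain a y where x: "x = a # y"
    using less.prems by (cases x) auto
  show ?case
  proof (cases y rule: rev_cases)
    case (snoc z b)
    show ?thesis
    proof
      assume "inv_word x = x"
      then have b: "inv_letter b = a" "inv_word z = z"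
        by (auto simp: x snoc)
      show False
      proof (cases "z = []")
        case True
        then show False
          using less.prems b by (auto simp: x snoc reduced_Cons)
      next
        case False
        then show False
          using less.hyps[of z] less.prems b by (auto simp: x snoc reduced_Cons reduced_append)
      qed
    qed
  qed (simp add: x)
qed

lemma occ_inv_word: "occ (inv_word x) (inv_word w) = occ x w"
  unfolding occ_def
proof (rule bij_betw_same_card[symmetric])
  show "bij_betw (\<lambda>(u, v). (inv_word v, inv_word u)) {(u, v). x = u @ w @ v}
      {(u, v). inv_word x = u @ inv_word w @ v}"
    by (rule bij_betw_byWitness[where f' = "\<lambda>(u, v). (inv_word v, inv_word u)"])
      (auto simp: inv_word_eq_iff)
qed

text \<open>The homomorphism from the free monoid on the letters onto \<open>F2\<close>; it lets
  products be computed on unreduced words.\<close>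

definition reduce :: "word \<Rightarrow> word" where
  "reduce x = foldr cons_reduce x []"

lemma reduced_reduce [simp]: "reduced (reduce x)"
  by (simp add: reduce_def reduced_foldr)

lemma reduce_reduced: "reduced x \<Longrightarrow> reduce x = x"
  by (simp add: reduce_def foldr_cons_reduce_Nil)

lemma reduce_append: "reduce (x @ y) = reduce x \<otimes>\<^bsub>F2\<^esub> reduce y"
  using foldr_cons_reduce_assoc[of "reduce y" x "[]"] by (simp add: F2_def reduce_def reduced_foldr)

lemma carrier_F2 [simp]: "x \<in> carrier F2 \<longleftrightarrow> reduced x"
  by (simp add: F2_def)

lemma one_F2: "\<one>\<^bsub>F2\<^esub> = []"
  by (simp add: F2_def)

interpretation F2: group F2
  by (rule group_F2)

lemma reduce_inv_word_cancel:
  "reduce (inv_word x @ x @ y) = reduce y" "reduce (x @ inv_word x @ y) = reduce y"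
proof -
  have *: "reduce (inv_word x @ x @ y) = reduce y" for x
  proof (induction x)
    case (Cons a x)
    have "reduce (inv_letter a # a # x @ y) = reduce (x @ y)"
      using cons_reduce_cancel[of "reduce (x @ y)" "inv_letter a"]
      by (simp add: reduce_def reduced_foldr flip: foldr_append)
    then have "reduce (inv_word x @ inv_letter a # a # x @ y) = reduce (inv_word x @ x @ y)"
      by (simp add: reduce_append)
    then show ?case
      using Cons by simp
  qed simp
  show "reduce (inv_word x @ x @ y) = reduce y" "reduce (x @ inv_word x @ y) = reduce y"
    using *[of x] *[of "inv_word x"] by simp_all
qed

lemma inv_F2: "reduced x \<Longrightarrow> inv\<^bsub>F2\<^esub> x = inv_word x"
  using reduce_inv_word_cancel(1)[of x "[]"] reduce_append[of "inv_word x" x]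
  by (intro F2.inv_equality) (auto simp: reduce_reduced one_F2)

lemma inv_reduce: "inv\<^bsub>F2\<^esub> (reduce x) = reduce (inv_word x)"
  using reduce_inv_word_cancel(1)[of x "[]"] reduce_append[of "inv_word x" x]
  by (intro F2.inv_equality) (auto simp: reduce_reduced one_F2)

lemma reduce_power: "reduce x [^]\<^bsub>F2\<^esub> (t :: nat) = reduce (concat (replicate t x))"
proof (induction t)
  case 0
  then show ?case
    by (simp add: one_F2 reduce_def)
next
  case (Suc t)
  have "reduce x [^]\<^bsub>F2\<^esub> Suc t = reduce x \<otimes>\<^bsub>F2\<^esub> reduce x [^]\<^bsub>F2\<^esub> t"
    by (rule F2.nat_pow_Suc2) simp
  then show ?case
    by (simp only: Suc reduce_append replicate_Suc concat.simps)
qed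

text \<open>Induction on \<open>g\<close>: a new first letter can cancel only when \<open>u\<close>
  is empty, and then it moves into \<open>c\<close>; otherwise it extends \<open>u\<close>.\<close>

lemma F2_mult_decomposition:
  assumes "reduced g" "reduced h"
  obtains u c v where "g = u @ c" "h = inv_word c @ v" "g \<otimes>\<^bsub>F2\<^esub> h = u @ v"
proof -
  have "\<exists>u c v. g = u @ c \<and> h = inv_word c @ v \<and> foldr cons_reduce g h = u @ v"
    using assms(1)
  proof (induction g)
    case (Cons a g)
    then obtain u c v where IH: "g = u @ c" "h = inv_word c @ v" "foldr cons_reduce g h = u @ v"
      by (auto simp: reduced_Cons)
    show ?case
    proof (cases "u = [] \<and> v \<noteq> [] \<and> hd v = inv_letter a")
      case True
      then obtain v' where "v = inv_letter a # v'"
        by (cases v) auto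
      then show ?thesis
        using IH True by (intro exI[of _ "[]"] exI[of _ "a # c"] exI[of _ v']) auto
    next
      case False
      then have "cons_reduce a (u @ v) = a # u @ v"
        using Cons.prems IH by (cases u; cases v) (auto simp: reduced_Cons)
      then show ?thesis
        using IH by (intro exI[of _ "a # u"] exI[of _ c] exI[of _ v]) auto
    qed
  qed auto
  then show ?thesis
    using that by (auto simp: F2_def)
qed

lemma reduced_concat_replicate:
  assumes "reduced x" "x \<noteq> []" "hd x \<noteq> inv_letter (last x)"
  shows "reduced (concat (replicate t x))"
proof (induction t)
  case (Suc t)
  then show ?case
    using assms by (cases t) (auto simp: reduced_append)
qed simp

section \<open>The counting quasimorphism\<close>

text \<open>The counting quasimorphism of Brooks, with overlaps counted.\<close>

definition brooks :: "word \<Rightarrow> word \<Rightarrow> int" where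
  "brooks w x = int (occ x w) - int (occ x (inv_word w))"

lemma brooks_inv_word [simp]: "brooks w (inv_word x) = - brooks w x"
  using occ_inv_word[of x w] occ_inv_word[of x "inv_word w"] by (simp add: brooks_def)

lemma brooks_Nil [simp]: "w \<noteq> [] \<Longrightarrow> brooks w [] = 0"
  by (simp add: brooks_def occ_Nil)

text \<open>The excess counts of \<open>w\<close> and of its inverse both lie between 0 and l - 1,
  hence so does the absolute value of their difference.\<close>

lemma brooks_append:
  assumes "w \<noteq> []"
  shows "\<bar>brooks w (x @ y) - brooks w x - brooks w y\<bar> \<le> int (length w) - 1"
proof -
  have "1 \<le> length w"
    using assms by (cases w) auto
  then show ?thesis
    using occ_append_ge[of w x y] occ_append_le[of w x y] assms
      occ_append_ge[of "inv_word w" x y] occ_append_le[of "inv_word w" x y]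
    by (auto simp: brooks_def)
qed

text \<open>The values on \<open>c\<close> and on its inverse cancel, so only the errors at the
  three junctions remain.\<close>

lemma brooks_mult:
  assumes "w \<noteq> []" "reduced g" "reduced h"
  shows "\<bar>brooks w (g \<otimes>\<^bsub>F2\<^esub> h) - brooks w g - brooks w h\<bar> \<le> 3 * (int (length w) - 1)"
proof -
  obtain u c v where "g = u @ c" "h = inv_word c @ v" "g \<otimes>\<^bsub>F2\<^esub> h = u @ v"
    using F2_mult_decomposition assms(2,3) .
  then show ?thesis
    using brooks_append[OF assms(1), of u c] brooks_append[OF assms(1), of "inv_word c" v]
      brooks_append[OF assms(1), of u v] by simp
qed

lemma brooks_overlap:
  assumes "w \<noteq> []" "length w \<le> length s"
  shows "brooks w (x @ s @ y) = brooks w (x @ s) + brooks w (s @ y) - brooks w s"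
  using occ_overlap[of w s x y] occ_overlap[of "inv_word w" s x y] assms
  by (simp add: brooks_def)

lemma brooks_replicate_append:
  assumes "w \<noteq> []" "hd w \<noteq> z" "last w \<noteq> inv_letter z"
  shows "brooks w (replicate k z @ x) = brooks w x"
proof -
  have "hd (inv_word w) \<noteq> z"
    using assms by auto
  then show ?thesis
    using assms by (simp add: brooks_def occ_replicate_append)
qed

lemma brooks_append_replicate:
  assumes "w \<noteq> []" "last w \<noteq> z" "hd w \<noteq> inv_letter z"
  shows "brooks w (x @ replicate k z) = brooks w x"
  using brooks_replicate_append[of w "inv_letter z" k "inv_word x"] assms
    brooks_inv_word[of w "x @ replicate k z"] by simp

text \<open>Cutting at each \<open>s\<close> splits the word into \<open>t\<close> overlapping
  pieces \<open>s @ r @ s\<close>; the overlaps contribute \<open>brooks w s = 0\<close>.\<close>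

lemma brooks_periodic:
  assumes "w \<noteq> []" "length w \<le> length s" "brooks w s = 0"
  shows "brooks w (concat (replicate t (s @ r)) @ s) = int t * brooks w (s @ r @ s)"
proof (induction t)
  case (Suc t)
  obtain q where q: "concat (replicate t (s @ r)) @ s = s @ q"
    by (cases t) auto
  have "brooks w ((s @ r) @ s @ q) = brooks w ((s @ r) @ s) + brooks w (s @ q) - brooks w s"
    using brooks_overlap assms by blast
  then show ?case
    using Suc q assms by (simp add: algebra_simps)
qed (use assms in simp)

lemma brooks_self:
  assumes "reduced w" "w \<noteq> []"
  shows "brooks w w = 1"
  using assms inv_word_neq[of w] by (simp add: brooks_def occ_short)

lemma brooks_short:
  assumes "length x < length w"
  shows "brooks w x = 0"
  using assms by (cases "w = []") (auto simp: brooks_def occ_short)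

section \<open>Recurrence in Meyer subsets\<close>

text \<open>The translates of \<open>W\<close> by points of \<open>K\<close> are open and cover
  \<open>K\<close>; the sets \<open>N d\<close> in the proof are these translates, written as
  preimages.\<close>

lemma compactin_translate_cover:
  assumes "locally_compact_group H T" "compactin T K" "openin T W" "\<one>\<^bsub>H\<^esub> \<in> W"
  shows "\<exists>D. finite D \<and> D \<subseteq> carrier H \<and> (\<forall>x\<in>K. \<exists>d\<in>D. inv\<^bsub>H\<^esub> d \<otimes>\<^bsub>H\<^esub> x \<in> W)"
proof -
  interpret H: group H
    using assms by (simp add: locally_compact_group_def)
  have T: "topspace T = carrier H"
    and mult: "continuous_map (prod_topology T T) T (\<lambda>(x, y). x \<otimes>\<^bsub>H\<^esub> y)"
    using assms by (auto simp: locally_compact_group_def)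
  have K: "K \<subseteq> carrier H"
    using compactin_subset_topspace[OF assms(2)] T by simp
  define N where "N d = {x \<in> topspace T. inv\<^bsub>H\<^esub> d \<otimes>\<^bsub>H\<^esub> x \<in> W}" for d
  have openN: "openin T (N d)" if "d \<in> K" for d
  proof -
    have "inv\<^bsub>H\<^esub> d \<in> topspace T"
      using that K T by auto
    then have "continuous_map T (prod_topology T T) (\<lambda>x. (inv\<^bsub>H\<^esub> d, x))"
      by (simp add: continuous_map_pairedI)
    then have "continuous_map T T (\<lambda>x. inv\<^bsub>H\<^esub> d \<otimes>\<^bsub>H\<^esub> x)"
      using continuous_map_compose[OF _ mult, of T "\<lambda>x. (inv\<^bsub>H\<^esub> d, x)"] by (simp add: o_def)
    then show ?thesis
      using assms(3) unfolding N_def by (rule openin_continuous_map_preimage)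
  qed
  have "x \<in> N x" if "x \<in> K" for x
    using that K T assms(4) by (auto simp: N_def)
  then have "K \<subseteq> \<Union> (N ` K)"
    by blast
  then obtain \<N> where \<N>: "finite \<N>" "\<N> \<subseteq> N ` K" "K \<subseteq> \<Union> \<N>"
    using compactinD[OF assms(2), of "N ` K"] openN by auto
  then obtain D where "D \<subseteq> K" "finite D" "\<N> = N ` D"
    using finite_subset_image[OF \<N>(1,2)] by auto
  then show ?thesis
    using K \<N>(3) by (intro exI[of _ D]) (auto simp: N_def)
qed

lemma locally_compact_group_mult_nbhd:
  assumes "locally_compact_group H T" "openin T U" "\<one>\<^bsub>H\<^esub> \<in> U"
  shows "\<exists>V. openin T V \<and> \<one>\<^bsub>H\<^esub> \<in> V \<and> (\<forall>x\<in>V. \<forall>y\<in>V. x \<otimes>\<^bsub>H\<^esub> y \<in> U)"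
proof -
  interpret H: group H
    using assms by (simp add: locally_compact_group_def)
  have T: "topspace T = carrier H"
    and mult: "continuous_map (prod_topology T T) T (\<lambda>(x, y). x \<otimes>\<^bsub>H\<^esub> y)"
    using assms by (auto simp: locally_compact_group_def)
  let ?P = "{p \<in> topspace (prod_topology T T). (\<lambda>(x, y). x \<otimes>\<^bsub>H\<^esub> y) p \<in> U}"
  have "openin (prod_topology T T) ?P"
    using mult assms(2) by (rule openin_continuous_map_preimage)
  moreover have "(\<one>\<^bsub>H\<^esub>, \<one>\<^bsub>H\<^esub>) \<in> ?P"
    using T assms(3) by simp
  ultimately have "\<exists>A B. openin T A \<and> openin T B \<and> \<one>\<^bsub>H\<^esub> \<in> A \<and> \<one>\<^bsub>H\<^esub> \<in> B \<and> A \<times> B \<subseteq> ?P"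
    by (rule openin_prod_topology_alt[THEN iffD1, rule_format])
  then obtain A B where AB: "openin T A" "openin T B" "\<one>\<^bsub>H\<^esub> \<in> A" "\<one>\<^bsub>H\<^esub> \<in> B" "A \<times> B \<subseteq> ?P"
    by (elim exE conjE)
  have "x \<otimes>\<^bsub>H\<^esub> y \<in> U" if "x \<in> A" "y \<in> B" for x y
    using subsetD[OF AB(5), of "(x, y)"] that by simp
  then show ?thesis
    using AB by (intro exI[of _ "A \<inter> B"]) auto
qed

lemma locally_compact_group_inv_mult_nbhd:
  assumes "locally_compact_group H T" "openin T U" "\<one>\<^bsub>H\<^esub> \<in> U"
  shows "\<exists>V. openin T V \<and> \<one>\<^bsub>H\<^esub> \<in> V \<and> (\<forall>x\<in>V. \<forall>y\<in>V. inv\<^bsub>H\<^esub> x \<otimes>\<^bsub>H\<^esub> y \<in> U)"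
proof -
  interpret H: group H
    using assms by (simp add: locally_compact_group_def)
  have T: "topspace T = carrier H" and inv: "continuous_map T T (\<lambda>x. inv\<^bsub>H\<^esub> x)"
    using assms by (auto simp: locally_compact_group_def)
  obtain V where V: "openin T V" "\<one>\<^bsub>H\<^esub> \<in> V" "\<forall>x\<in>V. \<forall>y\<in>V. x \<otimes>\<^bsub>H\<^esub> y \<in> U"
    using locally_compact_group_mult_nbhd[OF assms] by (elim exE conjE)
  have "openin T {x \<in> topspace T. inv\<^bsub>H\<^esub> x \<in> V}"
    using inv V(1) by (rule openin_continuous_map_preimage)
  then show ?thesis
    using V T by (intro exI[of _ "V \<inter> {x \<in> topspace T. inv\<^bsub>H\<^esub> x \<in> V}"]) auto
qed

lemma locally_compact_group_power_nbhd:
  assumes "locally_compact_group H T" "openin T U" "\<one>\<^bsub>H\<^esub> \<in> U"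
  shows "\<exists>V. openin T V \<and> \<one>\<^bsub>H\<^esub> \<in> V \<and> (\<forall>x\<in>V. x [^]\<^bsub>H\<^esub> (t :: nat) \<in> U)"
  using assms(2,3)
proof (induction t arbitrary: U)
  case 0
  then show ?case
    by auto
next
  case (Suc t)
  obtain W where W: "openin T W" "\<one>\<^bsub>H\<^esub> \<in> W" "\<forall>x\<in>W. \<forall>y\<in>W. x \<otimes>\<^bsub>H\<^esub> y \<in> U"
    using locally_compact_group_mult_nbhd[OF assms(1) Suc.prems] by (elim exE conjE)
  obtain V where "openin T V" "\<one>\<^bsub>H\<^esub> \<in> V" "\<forall>x\<in>V. x [^]\<^bsub>H\<^esub> t \<in> W"
    using Suc.IH[OF W(1,2)] by (elim exE conjE)
  then show ?case
    using W by (intro exI[of _ "V \<inter> W"]) auto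
qed

lemma inv_mult_cancel_left:
  assumes "group G" "x \<in> carrier G" "y \<in> carrier G" "z \<in> carrier G"
  shows "inv\<^bsub>G\<^esub> (x \<otimes>\<^bsub>G\<^esub> y) \<otimes>\<^bsub>G\<^esub> (x \<otimes>\<^bsub>G\<^esub> z) = inv\<^bsub>G\<^esub> y \<otimes>\<^bsub>G\<^esub> z"
proof -
  interpret group G by fact
  have "inv\<^bsub>G\<^esub> x \<otimes>\<^bsub>G\<^esub> (x \<otimes>\<^bsub>G\<^esub> z) = z"
    using assms by (simp flip: m_assoc)
  then show ?thesis
    using assms by (simp add: inv_mult_group m_assoc)
qed

text \<open>All that is used of a good model, stated without \<open>H\<close>. The set
  \<open>F\<close> is fixed before \<open>t\<close>, while \<open>A\<close> may depend on
  \<open>t\<close>: a quasimorphism bounded on \<open>X\<close> is thus bounded on all these powers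
  uniformly in \<open>t\<close>.\<close>

lemma meyer_subset_recurrence:
  assumes "group G" "meyer_subset TYPE('h) G X"
  shows "\<exists>F. finite F \<and> F \<subseteq> carrier G \<and> (\<forall>t :: nat. \<exists>A. A \<subseteq> carrier G \<and> \<one>\<^bsub>G\<^esub> \<in> A \<and>
      (\<forall>g :: nat \<Rightarrow> _. range g \<subseteq> X \<longrightarrow> (\<exists>i j. i < j \<and> inv\<^bsub>G\<^esub> (g i) \<otimes>\<^bsub>G\<^esub> g j \<in> A)) \<and>
      (\<forall>x\<in>A. \<forall>y\<in>A. \<forall>z\<in>A. (x \<otimes>\<^bsub>G\<^esub> y \<otimes>\<^bsub>G\<^esub> z) [^]\<^bsub>G\<^esub> t \<in> F <#>\<^bsub>G\<^esub> X))"
proof -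
  interpret G: group G by fact
  obtain \<Lambda> F and H :: "'h monoid" and T f where \<Lambda>: "approximate_subgroup G \<Lambda>"
    and F: "finite F" "F \<subseteq> carrier G" "X \<subseteq> F <#>\<^bsub>G\<^esub> \<Lambda>" "\<Lambda> \<subseteq> F <#>\<^bsub>G\<^esub> X"
    and model: "good_model G \<Lambda> H T f"
    using assms(2) unfolding meyer_subset_def commensurable_def by blast
  define K where "K = T closure_of (f ` \<Lambda>)"
  obtain U where lc: "locally_compact_group H T"
    and hom: "f \<in> hom (G\<lparr>carrier := generate G \<Lambda>\<rparr>) H" and K: "compactin T K"
    and U: "U \<subseteq> carrier H" "\<one>\<^bsub>H\<^esub> \<in> T interior_of U" "{x \<in> generate G \<Lambda>. f x \<in> U} \<subseteq> \<Lambda>"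
    using model unfolding good_model_def K_def by blast
  have \<Lambda>_carrier: "\<Lambda> \<subseteq> carrier G"
    using \<Lambda> by (simp add: approximate_subgroup_def)
  let ?S = "generate G \<Lambda>"
  have sub: "subgroup ?S G"
    using \<Lambda>_carrier by (rule G.generate_is_subgroup)
  have grp: "group (G\<lparr>carrier := ?S\<rparr>)"
    using sub by (rule subgroup.subgroup_is_group) fact
  have grpH: "group H" and T: "topspace T = carrier H"
    using lc by (auto simp: locally_compact_group_def)
  interpret f: group_hom "G\<lparr>carrier := ?S\<rparr>" H f
    using grp grpH hom by (simp add: group_hom_def group_hom_axioms_def)
  interpret H: group H by fact
  have f_mult: "f (x \<otimes>\<^bsub>G\<^esub> y) = f x \<otimes>\<^bsub>H\<^esub> f y" if "x \<in> ?S" "y \<in> ?S" for x y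
    using f.hom_mult that by simp
  have f_closed: "f x \<in> carrier H" if "x \<in> ?S" for x
    using f.hom_closed that by simp
  have f_inv: "f (inv\<^bsub>G\<^esub> x) = inv\<^bsub>H\<^esub> (f x)" if "x \<in> ?S" for x
    using f.hom_inv[of x] that sub by (simp add: G.m_inv_consistent)
  have f_pow: "f (x [^]\<^bsub>G\<^esub> n) = f x [^]\<^bsub>H\<^esub> n" if "x \<in> ?S" for x and n :: nat
    using f.hom_nat_pow[of x n] that by (simp flip: G.nat_pow_consistent)
  have f_one: "f \<one>\<^bsub>G\<^esub> = \<one>\<^bsub>H\<^esub>"
    using f.hom_one by simp
  have pow_closed: "x [^]\<^bsub>G\<^esub> n \<in> ?S" if "x \<in> ?S" for x and n :: nat
    using monoid.nat_pow_closed[OF group.is_monoid[OF grp], of x n] that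
    by (simp flip: G.nat_pow_consistent)
  have fK: "f x \<in> K" if "x \<in> \<Lambda>" for x
    using that closure_of_subset[of "f ` \<Lambda>" T] f_closed T generate.incl[of _ \<Lambda> G]
    unfolding K_def by blast
  have rec: "\<exists>A. A \<subseteq> carrier G \<and> \<one>\<^bsub>G\<^esub> \<in> A \<and>
      (\<forall>g :: nat \<Rightarrow> _. range g \<subseteq> X \<longrightarrow> (\<exists>i j. i < j \<and> inv\<^bsub>G\<^esub> (g i) \<otimes>\<^bsub>G\<^esub> g j \<in> A)) \<and>
      (\<forall>x\<in>A. \<forall>y\<in>A. \<forall>z\<in>A. (x \<otimes>\<^bsub>G\<^esub> y \<otimes>\<^bsub>G\<^esub> z) [^]\<^bsub>G\<^esub> t \<in> F <#>\<^bsub>G\<^esub> X)" for t :: nat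
  proof -
    \<comment> \<open>The neighbourhoods shrink from \<open>U\<close> to \<open>W\<close>: quotients
      from \<open>W\<close> lie in \<open>V\<close>, products of three elements of \<open>V\<close>
      lie in \<open>V1\<close>, and \<open>t\<close>-th powers from \<open>V1\<close> lie in
      \<open>U\<close>.\<close>
    obtain V1 where V1: "openin T V1" "\<one>\<^bsub>H\<^esub> \<in> V1"
      "\<forall>x\<in>V1. x [^]\<^bsub>H\<^esub> t \<in> T interior_of U"
      using locally_compact_group_power_nbhd[OF lc openin_interior_of U(2), of t] by (elim exE conjE)
    obtain V2 where V2: "openin T V2" "\<one>\<^bsub>H\<^esub> \<in> V2" "\<forall>x\<in>V2. \<forall>y\<in>V2. x \<otimes>\<^bsub>H\<^esub> y \<in> V1"
      using locally_compact_group_mult_nbhd[OF lc V1(1,2)] by (elim exE conjE)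
    obtain V where V: "openin T V" "\<one>\<^bsub>H\<^esub> \<in> V" "\<forall>x\<in>V. \<forall>y\<in>V. x \<otimes>\<^bsub>H\<^esub> y \<in> V2"
      using locally_compact_group_mult_nbhd[OF lc V2(1,2)] by (elim exE conjE)
    obtain W where W: "openin T W" "\<one>\<^bsub>H\<^esub> \<in> W" "\<forall>x\<in>W. \<forall>y\<in>W. inv\<^bsub>H\<^esub> x \<otimes>\<^bsub>H\<^esub> y \<in> V"
      using locally_compact_group_inv_mult_nbhd[OF lc V(1,2)] by (elim exE conjE)
    obtain D where D: "finite D" "D \<subseteq> carrier H"
      "\<forall>x\<in>K. \<exists>d\<in>D. inv\<^bsub>H\<^esub> d \<otimes>\<^bsub>H\<^esub> x \<in> W"
      using compactin_translate_cover[OF lc K W(1,2)] by (elim exE conjE)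
    define A where "A = {x \<in> ?S. f x \<in> V}"
    have "\<exists>i j. i < j \<and> inv\<^bsub>G\<^esub> (g i) \<otimes>\<^bsub>G\<^esub> g j \<in> A" if "range g \<subseteq> X" for g :: "nat \<Rightarrow> 'a"
    proof -
      have "\<exists>c\<in>F. \<exists>s\<in>\<Lambda>. g i = c \<otimes>\<^bsub>G\<^esub> s" for i
        using that F(3) unfolding set_mult_def by blast
      then obtain c s where c: "\<And>i. c i \<in> F" and s: "\<And>i. s i \<in> \<Lambda>"
        and g: "\<And>i. g i = c i \<otimes>\<^bsub>G\<^esub> s i"
        by metis
      have "\<exists>d\<in>D. inv\<^bsub>H\<^esub> d \<otimes>\<^bsub>H\<^esub> f (s i) \<in> W" for i
        using D(3) fK s by blast
      then obtain d where d: "\<And>i. d i \<in> D" "\<And>i. inv\<^bsub>H\<^esub> (d i) \<otimes>\<^bsub>H\<^esub> f (s i) \<in> W"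
        by metis
      \<comment> \<open>Pigeonhole: two indices share the coset representative \<open>c\<close> in
        \<open>F\<close> and the centre \<open>d\<close> in \<open>D\<close>. In the quotient
        \<open>c\<close> cancels in \<open>G\<close> and \<open>d\<close> cancels in
        \<open>H\<close>, leaving a quotient of two elements of \<open>W\<close>.\<close>
      have "finite (range (\<lambda>i. (c i, d i)))"
        by (rule finite_subset[of _ "F \<times> D"]) (use c d F D in auto)
      then have "\<not> inj (\<lambda>i. (c i, d i))"
        using finite_imageD infinite_UNIV_nat by blast
      then obtain i j where ij: "i < j" "c i = c j" "d i = d j"
        using linorder_injI[of "\<lambda>i. (c i, d i)"] by auto
      have S: "s i \<in> ?S" "s j \<in> ?S"
        using s generate.incl by fast+
      have car: "s i \<in> carrier G" "s j \<in> carrier G" "c j \<in> carrier G" "d j \<in> carrier H"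
        "f (s i) \<in> carrier H" "f (s j) \<in> carrier H"
        using s c d \<Lambda>_carrier F D f_closed S by auto
      have "inv\<^bsub>G\<^esub> (g i) \<otimes>\<^bsub>G\<^esub> g j = inv\<^bsub>G\<^esub> (s i) \<otimes>\<^bsub>G\<^esub> s j"
        using car inv_mult_cancel_left[OF assms(1)] by (simp add: g ij)
      moreover have "inv\<^bsub>G\<^esub> (s i) \<in> ?S"
        using S sub by (simp add: subgroup.m_inv_closed)
      moreover have "inv\<^bsub>H\<^esub> (inv\<^bsub>H\<^esub> (d j) \<otimes>\<^bsub>H\<^esub> f (s i)) \<otimes>\<^bsub>H\<^esub> (inv\<^bsub>H\<^esub> (d j) \<otimes>\<^bsub>H\<^esub> f (s j)) =
          inv\<^bsub>H\<^esub> (f (s i)) \<otimes>\<^bsub>H\<^esub> f (s j)"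
        using car inv_mult_cancel_left[OF grpH] by simp
      ultimately have "inv\<^bsub>G\<^esub> (g i) \<otimes>\<^bsub>G\<^esub> g j \<in> A"
        using W(3)[rule_format, OF d(2)[of i] d(2)[of j]] S sub ij
        by (simp add: A_def f_mult f_inv subgroup.m_closed)
      then show ?thesis
        using ij by blast
    qed
    moreover have "(x \<otimes>\<^bsub>G\<^esub> y \<otimes>\<^bsub>G\<^esub> z) [^]\<^bsub>G\<^esub> t \<in> F <#>\<^bsub>G\<^esub> X" if "x \<in> A" "y \<in> A" "z \<in> A" for x y z
    proof -
      have S: "x \<in> ?S" "y \<in> ?S" "z \<in> ?S" and fV: "f x \<in> V" "f y \<in> V" "f z \<in> V"
        using that by (auto simp: A_def)
      \<comment> \<open>Multiplying by the identity, which is in \<open>V\<close>, puts the third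
        factor into \<open>V2\<close>.\<close>
      have "f z \<in> V2"
        using V(3)[rule_format, OF fV(3) V(2)] f_closed[OF S(3)] by simp
      then have "f x \<otimes>\<^bsub>H\<^esub> f y \<otimes>\<^bsub>H\<^esub> f z \<in> V1"
        using V2(3) V(3) fV by blast
      moreover have S': "x \<otimes>\<^bsub>G\<^esub> y \<in> ?S" "x \<otimes>\<^bsub>G\<^esub> y \<otimes>\<^bsub>G\<^esub> z \<in> ?S"
        using S sub by (simp_all add: subgroup.m_closed)
      ultimately have "f ((x \<otimes>\<^bsub>G\<^esub> y \<otimes>\<^bsub>G\<^esub> z) [^]\<^bsub>G\<^esub> t) \<in> T interior_of U"
        using V1(3) S by (simp add: f_pow f_mult)
      then have "(x \<otimes>\<^bsub>G\<^esub> y \<otimes>\<^bsub>G\<^esub> z) [^]\<^bsub>G\<^esub> t \<in> \<Lambda>"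
        using U(3) pow_closed[OF S'(2), of t] subsetD[OF interior_of_subset[of T U]] by auto
      then show ?thesis
        using F(4) by blast
    qed
    moreover have "A \<subseteq> carrier G" "\<one>\<^bsub>G\<^esub> \<in> A"
      using subgroup.subset[OF sub] V(2) by (auto simp: A_def f_one generate.one)
    ultimately show ?thesis
      by (intro exI[of _ A] conjI) simp_all
  qed
  show ?thesis
    by (intro exI[of _ F] conjI allI F(1,2) rec)
qed

section \<open>Sublevel sets of the quasimorphism are approximate subgroups\<close>

text \<open>Dividing a product by a representative with the same value leaves an element whose value
  is at most the defect, hence at most \<open>R\<close>. On products the value is bounded by
  \<open>B\<close>, so finitely many representatives suffice.\<close>

lemma approximate_subgroup_brooks:
  assumes "w \<noteq> []" "3 * (int (length w) - 1) \<le> R"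
  shows "approximate_subgroup F2 {g \<in> carrier F2. \<bar>brooks w g\<bar> \<le> R}"
proof -
  let ?L = "{g \<in> carrier F2. \<bar>brooks w g\<bar> \<le> R}"
  define B where "B = 2 * R + 3 * (int (length w) - 1)"
  \<comment> \<open>\<open>h n\<close> is arbitrary if the value \<open>n\<close> is not attained,
    hence the restriction in \<open>F\<close>.\<close>
  define h where "h n = (SOME g. reduced g \<and> brooks w g = n)" for n
  define F where "F = h ` {n \<in> {-B..B}. \<exists>g. reduced g \<and> brooks w g = n}"
  have h: "reduced (h n)" "brooks w (h n) = n" if "\<exists>g. reduced g \<and> brooks w g = n" for n
    using someI_ex[OF that] by (auto simp: h_def)
  have F: "finite F" "F \<subseteq> carrier F2"
  proof -
    have "finite {n \<in> {-B..B}. \<exists>g. reduced g \<and> brooks w g = n}"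
      by (rule finite_subset[of _ "{-B..B}"]) auto
    then show "finite F"
      by (simp only: F_def finite_imageI)
    show "F \<subseteq> carrier F2"
      unfolding F_def using h(1) by (intro image_subsetI) (simp only: carrier_F2 mem_Collect_eq)
  qed
  have "x \<otimes>\<^bsub>F2\<^esub> y \<in> F <#>\<^bsub>F2\<^esub> ?L" if "x \<in> ?L" "y \<in> ?L" for x y
  proof -
    let ?z = "x \<otimes>\<^bsub>F2\<^esub> y"
    let ?f = "h (brooks w ?z)"
    let ?g = "inv_word ?f \<otimes>\<^bsub>F2\<^esub> ?z"
    have red: "reduced ?z"
      using that F2.m_closed[of x y] by simp
    then have f: "reduced ?f" "brooks w ?f = brooks w ?z"
      using h by blast+
    have "\<bar>brooks w ?z\<bar> \<le> B"
      using brooks_mult[of w x y] assms that unfolding B_def mem_Collect_eq carrier_F2 by linarith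
    then have "?f \<in> F"
      using red by (auto simp: F_def)
    moreover have "?g \<in> ?L"
      using brooks_mult[of w "inv_word ?f" ?z] assms f red F2.m_closed[of "inv_word ?f" ?z] by simp
    moreover have "?f \<otimes>\<^bsub>F2\<^esub> ?g = ?z"
      using f red F2.m_assoc[of ?f "inv_word ?f" ?z] F2.r_inv[of ?f] F2.l_one[of ?z]
      by (simp add: inv_F2)
    ultimately show ?thesis
      unfolding set_mult_def by (intro UN_I[of ?f] UN_I[of ?g]) simp_all
  qed
  then have "?L <#>\<^bsub>F2\<^esub> ?L \<subseteq> F <#>\<^bsub>F2\<^esub> ?L"
    unfolding set_mult_def[of F2 ?L ?L] by blast
  moreover have "set_inv\<^bsub>F2\<^esub> ?L = ?L"
  proof -
    have "set_inv\<^bsub>F2\<^esub> ?L = inv_word ` ?L"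
      by (auto simp: SET_INV_def inv_F2)
    also have "\<dots> = ?L"
      by (auto simp: image_iff intro!: exI[of _ "inv_word _"])
    finally show ?thesis .
  qed
  ultimately show ?thesis
    using F assms by (auto simp: approximate_subgroup_def one_F2 intro!: exI[of _ F])
      (use assms in \<open>cases w; simp\<close>)
qed

section \<open>Elements along which the quasimorphism grows\<close>

text \<open>The condition on the end letters makes powers of \<open>e\<close> plain concatenations.
  The second \<open>s\<close> in \<open>s @ r @ s\<close> catches the occurrences across consecutive
  copies of \<open>e\<close>, so this value is the contribution of one period.\<close>

definition growing :: "word \<Rightarrow> word \<Rightarrow> bool" where
  "growing w e \<longleftrightarrow> reduced e \<and> hd e \<noteq> inv_letter (last e) \<and>
    (\<exists>s r. e = s @ r \<and> length w \<le> length s \<and> brooks w s = 0 \<and> brooks w (s @ r @ s) \<noteq> 0)"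

text \<open>Each period contributes the same nonzero integer; removing the closing \<open>s\<close>,
  of value 0, changes the total by at most l - 1.\<close>

lemma growing_power:
  assumes "w \<noteq> []" "growing w e"
  shows "int t - int (length w) \<le> \<bar>brooks w (e [^]\<^bsub>F2\<^esub> t)\<bar>"
proof -
  obtain s r where e: "reduced e" "hd e \<noteq> inv_letter (last e)" "e = s @ r"
    and s: "length w \<le> length s" "brooks w s = 0" "brooks w (s @ r @ s) \<noteq> 0"
    using assms by (auto simp: growing_def)
  let ?x = "concat (replicate t e)"
  have "e \<noteq> []"
    using e s assms by auto
  then have "e [^]\<^bsub>F2\<^esub> t = ?x"
    using reduce_power[of e t] e by (simp add: reduce_reduced reduced_concat_replicate)
  moreover have "int t \<le> \<bar>brooks w (?x @ s)\<bar>"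
  proof -
    have "int t * 1 \<le> int t * \<bar>brooks w (s @ r @ s)\<bar>"
      using s by (intro mult_left_mono) auto
    then show ?thesis
      using brooks_periodic[OF assms(1) s(1,2), of t r] e by (simp add: abs_mult)
  qed
  ultimately show ?thesis
    using brooks_append[OF assms(1), of ?x s] s by simp
qed

text \<open>What the constructions below take from recurrence. \<open>k \<ge> length w\<close> makes
  the power a separator, the bound 1 admits \<open>c = w\<close>, and \<open>[]\<close> allows
  products with fewer proper factors.\<close>

definition recurrent :: "word \<Rightarrow> word set \<Rightarrow> bool" where
  "recurrent w A \<longleftrightarrow> [] \<in> A \<and>
    (\<forall>z c. (\<forall>k. brooks w (replicate k z) = 0) \<longrightarrow> reduced c \<longrightarrow> \<bar>brooks w c\<bar> \<le> 1 \<longrightarrow>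
      (\<exists>k\<ge>length w. reduce (c @ replicate k z @ inv_word c) \<in> A))"

lemma recurrentI:
  assumes "w \<noteq> []" "[] \<in> A"
    and A: "\<And>g :: nat \<Rightarrow> _. range g \<subseteq> {g \<in> carrier F2. \<bar>brooks w g\<bar> \<le> 3 * int (length w)} \<Longrightarrow>
      \<exists>i j. i < j \<and> inv\<^bsub>F2\<^esub> (g i) \<otimes>\<^bsub>F2\<^esub> g j \<in> A"
  shows "recurrent w A"
  unfolding recurrent_def
proof (intro conjI allI impI)
  fix z c
  assume z: "\<forall>k. brooks w (replicate k z) = 0" and c: "reduced c" "\<bar>brooks w c\<bar> \<le> 1"
  let ?l = "length w"
  \<comment> \<open>The values are at most 3(l - 1) + 1, within the bound 3l. Exponents are
    multiples of \<open>?l\<close>, so for \<open>i < j\<close> their difference is at least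
    \<open>?l\<close>.\<close>
  define g where "g i = reduce (replicate (i * ?l) z @ inv_word c)" for i
  have "\<bar>brooks w (g i)\<bar> \<le> 3 * int ?l" for i
    using brooks_mult[OF assms(1), of "replicate (i * ?l) z" "inv_word c"] z c
    by (simp add: g_def reduce_append reduce_reduced)
  then have "range g \<subseteq> {g \<in> carrier F2. \<bar>brooks w g\<bar> \<le> 3 * int ?l}"
    by (auto simp: g_def)
  then obtain i j where ij: "i < j" "inv\<^bsub>F2\<^esub> (g i) \<otimes>\<^bsub>F2\<^esub> g j \<in> A"
    using A by blast
  define k where "k = (j - i) * ?l"
  have j: "replicate (j * ?l) z = replicate (i * ?l) z @ replicate k z"
    using ij by (simp add: k_def flip: replicate_add add_mult_distrib)
  have "inv\<^bsub>F2\<^esub> (g i) \<otimes>\<^bsub>F2\<^esub> g j =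
      reduce c \<otimes>\<^bsub>F2\<^esub> reduce (inv_word (replicate (i * ?l) z) @ replicate (i * ?l) z @ replicate k z @ inv_word c)"
    unfolding g_def inv_reduce by (simp add: j flip: reduce_append)
  also have "\<dots> = reduce (c @ replicate k z @ inv_word c)"
    by (simp only: reduce_inv_word_cancel flip: reduce_append)
  finally show "\<exists>k\<ge>?l. reduce (c @ replicate k z @ inv_word c) \<in> A"
    using ij by (intro exI[of _ k]) (auto simp: k_def)
qed fact

lemma not_meyer_subset_brooks:
  assumes "w \<noteq> []"
    and growing: "\<And>A. recurrent w A \<Longrightarrow>
      \<exists>x\<in>A. \<exists>y\<in>A. \<exists>z\<in>A. growing w (x \<otimes>\<^bsub>F2\<^esub> y \<otimes>\<^bsub>F2\<^esub> z)"
  shows "\<not> meyer_subset TYPE('h) F2 {g \<in> carrier F2. \<bar>brooks w g\<bar> \<le> 3 * int (length w)}"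
    (is "\<not> meyer_subset _ _ ?L")
proof
  assume meyer: "meyer_subset TYPE('h) F2 ?L"
  obtain F where F: "finite F" "F \<subseteq> carrier F2"
    and rec: "\<forall>t :: nat. \<exists>A. A \<subseteq> carrier F2 \<and> \<one>\<^bsub>F2\<^esub> \<in> A \<and>
      (\<forall>g :: nat \<Rightarrow> _. range g \<subseteq> ?L \<longrightarrow> (\<exists>i j. i < j \<and> inv\<^bsub>F2\<^esub> (g i) \<otimes>\<^bsub>F2\<^esub> g j \<in> A)) \<and>
      (\<forall>x\<in>A. \<forall>y\<in>A. \<forall>z\<in>A. (x \<otimes>\<^bsub>F2\<^esub> y \<otimes>\<^bsub>F2\<^esub> z) [^]\<^bsub>F2\<^esub> t \<in> F <#>\<^bsub>F2\<^esub> ?L)"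
    using meyer_subset_recurrence[OF group_F2 meyer] by (elim exE conjE)
  \<comment> \<open>On \<open>f g\<close> with \<open>f\<close> in \<open>F\<close>, the term 6l
    covers the value of \<open>g\<close>, at most 3l, and the defect.\<close>
  define C where "C = (\<Sum>f\<in>F. \<bar>brooks w f\<bar>) + 6 * int (length w)"
  have C: "\<bar>brooks w x\<bar> \<le> C" if x: "x \<in> F <#>\<^bsub>F2\<^esub> ?L" for x
  proof -
    obtain f g where fg: "f \<in> F" "g \<in> ?L" "x = f \<otimes>\<^bsub>F2\<^esub> g"
      using x by (auto simp: set_mult_def)
    have "\<bar>brooks w f\<bar> \<le> (\<Sum>f\<in>F. \<bar>brooks w f\<bar>)"
      using F fg by (intro member_le_sum) auto
    then show ?thesis
      using brooks_mult[OF assms(1), of f g] fg F by (auto simp: C_def)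
  qed
  \<comment> \<open>Large enough that the growth t - l exceeds \<open>C\<close>.\<close>
  define t where "t = nat (C + int (length w) + 1)"
  obtain A where A: "\<one>\<^bsub>F2\<^esub> \<in> A"
    "\<forall>g :: nat \<Rightarrow> _. range g \<subseteq> ?L \<longrightarrow> (\<exists>i j. i < j \<and> inv\<^bsub>F2\<^esub> (g i) \<otimes>\<^bsub>F2\<^esub> g j \<in> A)"
    "\<forall>x\<in>A. \<forall>y\<in>A. \<forall>z\<in>A. (x \<otimes>\<^bsub>F2\<^esub> y \<otimes>\<^bsub>F2\<^esub> z) [^]\<^bsub>F2\<^esub> t \<in> F <#>\<^bsub>F2\<^esub> ?L"
    using spec[OF rec, of t] by (elim exE conjE)
  have "recurrent w A"
  proof (rule recurrentI[OF assms(1)])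
    show "[] \<in> A"
      using A(1) by (simp only: one_F2)
  qed (use A(2) in blast)
  then obtain x y z where xyz: "x \<in> A" "y \<in> A" "z \<in> A" "growing w (x \<otimes>\<^bsub>F2\<^esub> y \<otimes>\<^bsub>F2\<^esub> z)"
    using growing by blast
  have "int t - int (length w) \<le> C"
    using growing_power[OF assms(1) xyz(4), of t] C[OF A(3)[rule_format, OF xyz(1-3)]]
    by (rule order_trans)
  moreover have "C + int (length w) + 1 \<le> int t"
    by (simp add: t_def)
  ultimately show False
    by linarith
qed

section \<open>Growing elements for the two types of end letters\<close>

lemma letter_cases: "fst a = fst b \<Longrightarrow> a = b \<or> a = inv_letter b"
  by (cases a; cases b) (auto simp: inv_letter_def)

text \<open>Comparing only generators makes the test insensitive to inverting letters, as suits
  words with alternating blocks.\<close>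

lemma reduced_appendI:
  "reduced x \<Longrightarrow> reduced y \<Longrightarrow> fst (hd y) \<noteq> fst (last x) \<Longrightarrow> reduced (x @ y)"
  by (auto simp: reduced_append)

lemma split_leading_letters:
  "\<exists>n u. w = replicate n x @ u \<and> (u = [] \<or> hd u \<noteq> x)"
proof (induction w)
  case (Cons a w)
  then obtain n u where u: "w = replicate n x @ u" "u = [] \<or> hd u \<noteq> x"
    by (elim exE conjE)
  show ?case
  proof (cases "a = x")
    case True
    then show ?thesis
      using u by (intro exI[of _ "Suc n"] exI[of _ u]) simp
  next
    case False
    then show ?thesis
      by (intro exI[of _ 0] exI[of _ "a # w"]) simp
  qed
qed simp

lemma split_trailing_letters:
  "\<exists>n u. w = u @ replicate n x \<and> (u = [] \<or> last u \<noteq> x)"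
proof -
  obtain n u where u: "rev w = replicate n x @ u" "u = [] \<or> hd u \<noteq> x"
    using split_leading_letters[of "rev w" x] by (elim exE conjE)
  have "w = rev u @ replicate n x"
    using arg_cong[OF u(1), of rev] by simp
  then show ?thesis
    using u(2) by (intro exI[of _ n] exI[of _ "rev u"]) (simp add: last_rev)
qed

lemma occ_append_replicate:
  assumes "w \<noteq> []" "last w \<noteq> z"
  shows "occ (x @ replicate k z) w = occ x w"
proof -
  have "hd (inv_word w) \<noteq> inv_letter z"
    using assms by (metis hd_inv_word inv_letter_invol)
  then have "occ (inv_word (x @ replicate k z)) (inv_word w) = occ (inv_word x) (inv_word w)"
    using assms by (simp add: occ_replicate_append)
  then show ?thesis
    by (simp only: occ_inv_word)
qed

text \<open>One period of x^k p x^-m p^-1 contains \<open>w\<close> exactly once, at the end of x^k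
  p, and never its inverse. The third factor is \<open>[]\<close>.\<close>

lemma recurrent_growing_distinct_ends:
  assumes w: "reduced w" "w \<noteq> []" "fst (hd w) \<noteq> fst (last w)" and "recurrent w A"
  shows "\<exists>x\<in>A. \<exists>y\<in>A. \<exists>z\<in>A. growing w (x \<otimes>\<^bsub>F2\<^esub> y \<otimes>\<^bsub>F2\<^esub> z)"
proof -
  define x where "x = hd w"
  then have hd_w: "hd w = x"
    by simp
  obtain i p where ip: "w = replicate i x @ p" "p = [] \<or> hd p \<noteq> x"
    using split_leading_letters[of w x] by (elim exE conjE)
  have "p \<noteq> []"
    using w ip hd_w by auto
  moreover have "i \<noteq> 0"
    using ip \<open>p \<noteq> []\<close> hd_w by (cases i) auto
  ultimately have p: "p \<noteq> []" "hd p \<noteq> x" "reduced p" "hd p \<noteq> inv_letter x" "length p < length w"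
    using ip w(1) by (auto simp: reduced_append)
  have fst_p: "fst (hd p) \<noteq> fst x" "fst (last p) \<noteq> fst x"
    using letter_cases[of "hd p" x] p w ip hd_w by auto
  have ends: "hd w = x" "last w \<noteq> x" "last w \<noteq> inv_letter x" "x \<noteq> inv_letter x" "inv_letter x \<noteq> x"
    using w fst_p ip p hd_w inv_letter_neq[of x] by (auto simp del: inv_letter_neq)
  have brooks_x: "brooks w (replicate k x) = 0" for k
    using brooks_append_replicate[of w x "[]" k] w ends by simp
  then have brooks_x': "brooks w (replicate k (inv_letter x)) = 0" for k
    using brooks_inv_word[of w "replicate k x"] by simp
  have brooks_p: "brooks w p = 0"
    using p by (intro brooks_short) simp
  have rec: "\<exists>k\<ge>length w. reduce (c @ replicate k y @ inv_word c) \<in> A"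
    if "\<And>k. brooks w (replicate k y) = 0" "reduced c" "brooks w c = 0" for y c
    using assms(4) that unfolding recurrent_def by (simp del: split_paired_All)
  obtain k where k: "k \<ge> length w" "reduce (replicate k x) \<in> A"
    using rec[OF brooks_x, of "[]"] w by auto
  obtain m where m: "m \<ge> length w" "reduce (p @ replicate m (inv_letter x) @ inv_word p) \<in> A"
    using rec[OF brooks_x' p(3) brooks_p] by auto
  have "0 < length w"
    using w by simp
  then have pos: "k \<noteq> 0" "m \<noteq> 0"
    using k m by linarith+
  define s where "s = replicate k x"
  define X where "X = replicate m (inv_letter x)"
  have s: "s \<noteq> []" "hd s = x" "last s = x" "reduced s" "length w \<le> length s"
    and X: "X \<noteq> []" "hd X = inv_letter x" "last X = inv_letter x" "reduced X" "length w \<le> length X"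
    using k m pos by (auto simp: s_def X_def)
  \<comment> \<open>An occurrence at an added \<open>x\<close> would, after cancelling x^i, make
    \<open>p\<close> start with \<open>x\<close>.\<close>
  have occ1: "occ (replicate n x @ w) w = 1" for n
  proof (induction n)
    case (Suc n)
    have "\<not> prefix w (x # replicate n x @ w)"
    proof
      assume "prefix w (x # replicate n x @ w)"
      moreover have "x # replicate n x @ w = replicate i x @ replicate (Suc n) x @ p"
        by (simp add: ip flip: replicate_add append_assoc replicate_Suc append_Cons)
      ultimately have "prefix p (replicate (Suc n) x @ p)"
        by (simp only: ip(1) same_prefix_prefix)
      then show False
        using p by (cases p) auto
    qed
    then show ?case
      using Suc by (simp add: occ_Cons)
  qed (use w in \<open>simp add: occ_short\<close>)
  \<comment> \<open>After cancelling x^i, an occurrence makes \<open>p\<close> start with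
    \<open>x\<close> or equal its own inverse. Inverted, this excludes the inverse of
    \<open>w\<close> from \<open>p @ X\<close>.\<close>
  have occ2: "occ (replicate n x @ inv_word p) w = 0" for n
  proof (induction n)
    case 0
    then show ?case
      using w p by (auto simp: occ_short)
  next
    case (Suc n)
    have "\<not> prefix w (replicate (Suc n) x @ inv_word p)"
    proof
      assume pre: "prefix w (replicate (Suc n) x @ inv_word p)"
      then have "i \<le> Suc n"
        using prefix_length_le[OF pre] ip by simp
      then have "replicate (Suc n) x = replicate i x @ replicate (Suc n - i) x"
        by (simp flip: replicate_add del: replicate_Suc)
      then have pre': "prefix p (replicate (Suc n - i) x @ inv_word p)"
        using pre by (simp only: ip(1) append_assoc same_prefix_prefix)
      show False
      proof (cases "Suc n - i")
        case 0
        then have "prefix p (inv_word p)"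
          using pre' by simp
        then have "p = inv_word p"
          by (auto simp: prefix_def) (metis append_Nil2 append_eq_append_conv inv_word_simps(5))
        then show False
          using inv_word_neq[of p] p by simp
      next
        case Suc
        then show False
          using pre' p by (cases p) auto
      qed
    qed
    then show ?case
      using Suc by (simp add: occ_Cons)
  qed
  have "brooks w ((s @ p) @ X) = 1"
  proof -
    have "occ ((s @ p) @ X) w = occ (s @ p) w"
      using w ends by (simp add: X_def occ_append_replicate del: append_assoc)
    also have "\<dots> = occ (replicate (k - i) x @ w) w"
      using k ip by (simp add: s_def flip: append_assoc replicate_add)
    also have "\<dots> = 1"
      by (rule occ1)
    finally have "occ ((s @ p) @ X) w = 1" .
    moreover have "occ (s @ p @ X) (inv_word w) = occ (p @ X) (inv_word w)"
      using w ends unfolding s_def by (intro occ_replicate_append) (auto dest: arg_cong[of _ _ inv_letter])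
    moreover have "occ (p @ X) (inv_word w) = 0"
      using occ_inv_word[of "p @ X" "inv_word w"] occ2[of m] by (simp add: X_def)
    ultimately show ?thesis
      by (simp add: brooks_def)
  qed
  moreover have "brooks w (X @ inv_word p @ s) = 0"
  proof -
    have "brooks w (X @ inv_word p @ s) = brooks w (inv_word p @ s)"
      unfolding X_def by (intro brooks_replicate_append) (simp_all add: w ends)
    also have "\<dots> = 0"
      unfolding s_def by (subst brooks_append_replicate) (simp_all add: w ends brooks_p)
    finally show ?thesis .
  qed
  ultimately have "brooks w (s @ (p @ X @ inv_word p) @ s) = 1"
    using brooks_overlap[OF w(2) X(5), of "s @ p" "inv_word p @ s"] brooks_x'[of m]
    by (simp add: X_def)
  moreover have red: "reduced (s @ p @ X @ inv_word p)"
    using s X p fst_p by (intro reduced_appendI) auto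
  moreover have "hd (s @ p @ X @ inv_word p) \<noteq> inv_letter (last (s @ p @ X @ inv_word p))"
    using s p by auto
  ultimately have "growing w (s @ p @ X @ inv_word p)"
    unfolding growing_def using s brooks_x[of k]
    by (intro conjI exI[of _ s] exI[of _ "p @ X @ inv_word p"]) (auto simp: s_def)
  moreover have "reduce s \<otimes>\<^bsub>F2\<^esub> reduce (p @ X @ inv_word p) \<otimes>\<^bsub>F2\<^esub> [] = s @ p @ X @ inv_word p"
    using red F2.r_one[of "reduce (s @ p @ X @ inv_word p)"]
    by (simp add: one_F2 reduce_reduced flip: reduce_append)
  moreover have "[] \<in> A"
    using assms(4) by (simp add: recurrent_def)
  moreover have "reduce s \<in> A" "reduce (p @ X @ inv_word p) \<in> A"
    using k(2) m(2) by (simp_all only: s_def X_def)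
  ultimately show ?thesis
    by (intro bexI[of _ "reduce s"] bexI[of _ "reduce (p @ X @ inv_word p)"] bexI[of _ "[]"]) simp_all
qed

text \<open>In the product of z^k1, c z^k2 c^-1 and w z^k3 w^-1 the middle c^-1 w reduces to
  \<open>d\<close>. The blocks of \<open>z\<close> make values add up to 0 +
  \<open>brooks w d\<close> - 1.\<close>

lemma recurrent_growing_equal_ends:
  assumes w: "reduced w" "2 \<le> length w" "fst (hd w) = fst (last w)" and "recurrent w A"
  shows "\<exists>x\<in>A. \<exists>y\<in>A. \<exists>z\<in>A. growing w (x \<otimes>\<^bsub>F2\<^esub> y \<otimes>\<^bsub>F2\<^esub> z)"
proof -
  define x where "x = last w"
  then have last_w: "last w = x"
    by simp
  obtain n u where nu: "w = u @ replicate n x" "u = [] \<or> last u \<noteq> x"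
    using split_trailing_letters[of w x] by (elim exE conjE)
  have "w \<noteq> []"
    using w by auto
  then have "n \<noteq> 0"
    using nu last_w by (cases n) auto
  have "fst (last u) \<noteq> fst x" if "u \<noteq> []"
    using letter_cases[of "last u" x] that nu w(1) \<open>n \<noteq> 0\<close> by (auto simp: reduced_append)
  note u = this
  \<comment> \<open>The generator that does not occur at either end of \<open>w\<close>; the sign is
    arbitrary.\<close>
  define z :: letter where "z = (if fst x = Gen_a then Gen_b else Gen_a, True)"
  have z: "fst x \<noteq> fst z"
    by (simp add: z_def)
  then have ends: "hd w \<noteq> z" "hd w \<noteq> inv_letter z" "last w \<noteq> z" "last w \<noteq> inv_letter z"
    using w(3) last_w by auto
  have brooks_z: "brooks w (replicate k z) = 0" for k
    using brooks_append_replicate[of w z "[]" k] \<open>w \<noteq> []\<close> ends by simp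
  have sep: "brooks w (y @ replicate k z @ v) = brooks w y + brooks w v" if "length w \<le> k" for y k v
    using brooks_overlap[of w "replicate k z" y v] brooks_append_replicate[of w z y k]
      brooks_replicate_append[of w z k v] brooks_z that \<open>w \<noteq> []\<close> ends by simp
  define c where "c = u @ [inv_letter x]"
  define d where "d = replicate (Suc n) x"
  \<comment> \<open>As \<open>c\<close> is no longer than \<open>w\<close>, only
    \<open>c = w\<close> or \<open>c = inv_word w\<close> could count. The first fails at the last
    letter; the second gives \<open>hd w = inv_letter x\<close>, hence
    \<open>last c = x\<close>.\<close>
  have brooks_c: "brooks w c = 0"
  proof (cases "u = []")
    case True
    then show ?thesis
      using w by (intro brooks_short) (simp add: c_def)
  next
    case False
    have len: "length c \<le> length w"
      using nu \<open>n \<noteq> 0\<close> by (simp add: c_def)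
    have "last c \<noteq> last w"
      by (simp add: c_def last_w)
    then have "c \<noteq> w"
      by blast
    moreover have "c \<noteq> inv_word w"
    proof
      assume eq: "c = inv_word w"
      have "hd w = hd c"
        using False nu by (simp add: c_def)
      also have "\<dots> = inv_letter x"
        using \<open>w \<noteq> []\<close> by (simp add: eq last_w)
      finally have "last c = x"
        using \<open>w \<noteq> []\<close> by (simp add: eq)
      then show False
        by (simp add: c_def)
    qed
    ultimately show ?thesis
      using len \<open>w \<noteq> []\<close> by (simp add: brooks_def occ_short)
  qed
  \<comment> \<open>If \<open>u\<close> is empty, \<open>d\<close> is \<open>w\<close> with one more
    \<open>x\<close> and contains \<open>w\<close> twice; otherwise \<open>d\<close> is no longer
    than \<open>w\<close> and lacks the letter \<open>last u\<close>, so it contains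
    \<open>w\<close> zero times.\<close>
  have brooks_d: "brooks w d \<noteq> 1"
  proof -
    have "hd (inv_word w) \<noteq> x"
      using \<open>w \<noteq> []\<close> by (simp add: last_w)
    then have "occ d (inv_word w) = 0"
      using occ_replicate_append[of "inv_word w" x "Suc n" "[]"] \<open>w \<noteq> []\<close>
      by (simp add: d_def occ_Nil)
    moreover have "occ d w \<noteq> 1"
    proof (cases "u = []")
      case True
      then have "d = x # w" "prefix w d"
        using nu by (auto simp: d_def prefix_def replicate_append_same intro!: exI[of _ "[x]"])
      then show ?thesis
        using \<open>w \<noteq> []\<close> by (simp add: occ_Cons occ_short)
    next
      case False
      then have "last u \<in> set w" "last u \<notin> set d"
        using nu by (auto simp: d_def)
      then have "d \<noteq> w"
        by auto
      moreover have "length d \<le> length w"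
        using False nu by (cases u) (auto simp: d_def)
      ultimately show ?thesis
        using \<open>w \<noteq> []\<close> by (simp add: occ_short)
    qed
    ultimately show ?thesis
      by (simp add: brooks_def)
  qed
  have brooks_w: "brooks w w = 1"
    using w \<open>w \<noteq> []\<close> by (simp add: brooks_self)
  have red: "reduced c" "reduced d"
    using u w nu unfolding c_def d_def by (auto intro!: reduced_appendI simp: reduced_append reduced_Cons inj_eq[OF inj_inv_letter] simp del: replicate_Suc)
  have rec: "\<exists>k\<ge>length w. reduce (v @ replicate k z @ inv_word v) \<in> A"
    if "reduced v" "\<bar>brooks w v\<bar> \<le> 1" for v
    using assms(4) that brooks_z unfolding recurrent_def by blast
  obtain k1 where k1: "k1 \<ge> length w" "reduce (replicate k1 z) \<in> A"
    using rec[of "[]"] \<open>w \<noteq> []\<close> by auto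
  obtain k2 where k2: "k2 \<ge> length w" "reduce (c @ replicate k2 z @ inv_word c) \<in> A"
    using rec[of c] red brooks_c by auto
  obtain k3 where k3: "k3 \<ge> length w" "reduce (w @ replicate k3 z @ inv_word w) \<in> A"
    using rec[of w] w brooks_w by auto
  define r where "r = c @ replicate k2 z @ d @ replicate k3 z @ inv_word w"
  have pos: "k1 \<noteq> 0" "k2 \<noteq> 0" "k3 \<noteq> 0"
    using k1(1) k2(1) k3(1) w(2) by linarith+
  have cd: "c \<noteq> []" "d \<noteq> []" "fst (hd c) = fst x" "fst (last c) = fst x"
    "fst (hd d) = fst x" "fst (last d) = fst x" "fst (hd w) = fst x" "fst (last w) = fst x"
  proof -
    show "fst (hd w) = fst x" "fst (last w) = fst x"
      using w(3) last_w by simp_all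
    moreover have "hd c = (if u = [] then inv_letter x else hd w)"
      by (simp add: c_def nu(1))
    ultimately show "fst (hd c) = fst x"
      by simp
  qed (simp_all add: c_def d_def last_replicate del: replicate_Suc)
  have red_r: "reduced (replicate k1 z @ r)"
    unfolding r_def using red w cd z pos \<open>w \<noteq> []\<close>
    by (intro reduced_appendI) auto
  have "hd (replicate k1 z @ r) \<noteq> inv_letter (last (replicate k1 z @ r))"
    using pos cd z \<open>w \<noteq> []\<close> by (auto simp: r_def last_w)
  moreover have "brooks w (replicate k1 z @ r @ replicate k1 z) = brooks w d - 1"
  proof -
    have "brooks w (replicate k1 z @ r @ replicate k1 z) = brooks w (r @ replicate k1 z @ [])"
      using sep[OF k1(1), of "[]"] \<open>w \<noteq> []\<close> by simp
    also have "\<dots> = brooks w r"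
      using sep[OF k1(1), of r "[]"] \<open>w \<noteq> []\<close> by simp
    also have "\<dots> = brooks w d - 1"
      unfolding r_def using sep k2(1) k3(1) brooks_c brooks_w by simp
    finally show ?thesis .
  qed
  ultimately have "growing w (replicate k1 z @ r)"
    unfolding growing_def using red_r brooks_d brooks_z k1(1)
    by (intro conjI exI[of _ "replicate k1 z"] exI[of _ r]) auto
  moreover have "reduce (replicate k1 z) \<otimes>\<^bsub>F2\<^esub> reduce (c @ replicate k2 z @ inv_word c) \<otimes>\<^bsub>F2\<^esub>
      reduce (w @ replicate k3 z @ inv_word w) = replicate k1 z @ r"
  proof -
    \<comment> \<open>The word is cut so that c^-1 w appears as \<open>x\<close>, then
      \<open>inv_word u @ u\<close>, then x^n.\<close>
    let ?y = "replicate k1 z @ c @ replicate k2 z @ [x]"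
    let ?v = "replicate n x @ replicate k3 z @ inv_word w"
    have "reduce (replicate k1 z) \<otimes>\<^bsub>F2\<^esub> reduce (c @ replicate k2 z @ inv_word c) \<otimes>\<^bsub>F2\<^esub>
        reduce (w @ replicate k3 z @ inv_word w) = reduce (?y @ inv_word u @ u @ ?v)"
      unfolding reduce_append[symmetric] by (subst nu(1)) (simp add: c_def)
    also have "\<dots> = reduce (?y @ ?v)"
      unfolding reduce_append[of ?y] reduce_inv_word_cancel ..
    also have "?y @ ?v = replicate k1 z @ r"
      by (simp add: r_def d_def)
    finally show ?thesis
      using red_r by (simp add: reduce_reduced)
  qed
  ultimately show ?thesis
    using k1(2) k2(2) k3(2)
    by (intro bexI[of _ "reduce (replicate k1 z)"] bexI[of _ "reduce (c @ replicate k2 z @ inv_word c)"]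
        bexI[of _ "reduce (w @ replicate k3 z @ inv_word w)"]) simp_all
qed

theorem theorem1p3:
  fixes w :: word
  assumes "w \<in> carrier F2 - {gen_a, gen_b, inv\<^bsub>F2\<^esub> gen_a, inv\<^bsub>F2\<^esub> gen_b, \<one>\<^bsub>F2\<^esub>}"
  defines "\<Lambda> \<equiv> {g \<in> carrier F2. \<bar>int (occ g w) - int (occ g (inv\<^bsub>F2\<^esub> w))\<bar> \<le> 3 * int (length w)}"
  shows "approximate_subgroup F2 \<Lambda> \<and> \<not> meyer_subset TYPE('h) F2 \<Lambda>"
proof -
  have red: "reduced w"
    using assms(1) by simp
  have gens: "inv\<^bsub>F2\<^esub> gen_a = [(Gen_a, False)]" "inv\<^bsub>F2\<^esub> gen_b = [(Gen_b, False)]"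
    by (simp_all add: inv_F2 gen_a_def gen_b_def reduced_Cons inv_letter_def)
  have "w \<noteq> []"
    using assms(1) by (auto simp: one_F2)
  \<comment> \<open>The excluded elements are exactly the words of length at most one.\<close>
  have "w \<noteq> [(g, b)]" for g b
    using assms(1) gens by (cases g; cases b) (auto simp: gen_a_def gen_b_def)
  then have len: "2 \<le> length w"
    using \<open>w \<noteq> []\<close> by (cases w rule: remdups_adj.cases) auto
  have \<Lambda>: "\<Lambda> = {g \<in> carrier F2. \<bar>brooks w g\<bar> \<le> 3 * int (length w)}"
    using red by (simp add: \<Lambda>_def brooks_def inv_F2)
  have "approximate_subgroup F2 \<Lambda>"
    unfolding \<Lambda> using \<open>w \<noteq> []\<close> by (intro approximate_subgroup_brooks) auto
  moreover have "\<not> meyer_subset TYPE('h) F2 \<Lambda>"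
    unfolding \<Lambda>
  proof (rule not_meyer_subset_brooks)
    fix A
    assume "recurrent w A"
    then show "\<exists>x\<in>A. \<exists>y\<in>A. \<exists>z\<in>A. growing w (x \<otimes>\<^bsub>F2\<^esub> y \<otimes>\<^bsub>F2\<^esub> z)"
      using recurrent_growing_distinct_ends recurrent_growing_equal_ends red len \<open>w \<noteq> []\<close>
      by blast
  qed fact
  ultimately show ?thesis
    by simp
qed

end
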